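(* The group $PSL(2,\mathfrak L)$ has the finite presentation $$PSL(2,\mathfrak L)=\langle T,\tau_{\mathbf i},\tau_{\mathbf j},\tau_{\mathbf k}\mid \mathfrak R_{\mathfrak L}\rangle,$$ where $\mathfrak R_{\mathfrak L}$ consists of the relators $T^2$; $[\tau_{\mathbf i},\tau_{\mathbf j}]$, $[\tau_{\mathbf i},\tau_{\mathbf k}]$, $[\tau_{\mathbf k},\tau_{\mathbf j}]$; $(\tau_{\mathbf i}T)^6$, $(\tau_{\mathbf j}T)^6$, $(\tau_{\mathbf k}T)^6$; $(\tau_{\mathbf i}\tau_{\mathbf j}T)^4$, $(\tau_{\mathbf i}\tau_{\mathbf k}T)^4$, $(\tau_{\mathbf j}\tau_{\mathbf k}T)^4$; $(\tau_{\mathbf i}\tau_{\mathbf j}\tau_{\mathbf k}T)^6$; $(\tau_{\mathbf i}T)^3(\tau_{\mathbf j}T)^3(\tau_{\mathbf k}T)^3$, $(\tau_{\mathbf i}T)^3(\tau_{\mathbf k}T)^3(\tau_{\mathbf j}T)^3$; $[(\tau_{\mathbf u}T)^3,T]$ for $\mathbf u\in\{\mathbf i,\mathbf j,\mathbf k\}$; $[(\tau_{\mathbf u}T)^3,\tau_{\mathbf u}]$ for $\mathbf u\in\{\mathbf i,\mathbf j,\mathbf k\}$; and $(\tau_{\mathbf u}T)^3\tau_{\mathbf w}(\tau_{\mathbf u}T)^3\tau_{\mathbf w}$ for all $\mathbf u\neq\mathbf w$ in $\{\mathbf i,\mathbf j,\mathbf k\}$.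
   Context: $[x,y]=xyx^{-1}y^{-1}$ denotes the commutator. $PSL(2,\mathfrak L)$ is the group of transformations of $\mathbf H^1_{\mathbb H}=\{q\in\mathbb H:\Re q>0\}$ generated by the inversion $T(q)=q^{-1}$ and the translations $\tau_\omega(q)=q+\omega$, $\omega\in\{b\mathbf i+c\mathbf j+d\mathbf k:b,c,d\in\mathbb Z\}$; $\tau_{\mathbf i},\tau_{\mathbf j},\tau_{\mathbf k}$ are the translations by $\mathbf i,\mathbf j,\mathbf k$. (Here $(\tau_{\mathbf u}T)^3$ equals the map $q\mapsto\mathbf u q\mathbf u^{-1}$.) *)

theory Defs
  imports Main "HOL.Real"
begin

datatype quat = Quat (Re: real) (Im_i: real) (Im_j: real) (Im_k: real)

definition qadd :: "quat \<Rightarrow> quat \<Rightarrow> quat" where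
  "qadd p q = Quat (Re p + Re q) (Im_i p + Im_i q) (Im_j p + Im_j q) (Im_k p + Im_k q)"

definition qnormsq :: "quat \<Rightarrow> real" where
  "qnormsq q = (Re q)^2 + (Im_i q)^2 + (Im_j q)^2 + (Im_k q)^2"

definition qinv :: "quat \<Rightarrow> quat" where
  "qinv q = Quat (Re q / qnormsq q) (- Im_i q / qnormsq q) (- Im_j q / qnormsq q) (- Im_k q / qnormsq q)"

definition H1 :: "quat set" where
  "H1 = {q. Re q > 0}"

definition Tmap :: "quat \<Rightarrow> quat" where
  "Tmap q = qinv q"

definition tau :: "int \<Rightarrow> int \<Rightarrow> int \<Rightarrow> quat \<Rightarrow> quat" where
  "tau b c d q = qadd q (Quat 0 (of_int b) (of_int c) (of_int d))"

text \<open>PSL(2,L): the group of transformations generated by T and all lattice translations.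
  Since this generating set is closed under inverses (T^-1 = T, tau_w^-1 = tau_{-w}),
  the generated group is the set of finite compositions of generators.
  Transformations are compared on H1 only.\<close>
inductive_set PSL2L :: "(quat \<Rightarrow> quat) set" where
  id_in: "id \<in> PSL2L"
| T_in: "f \<in> PSL2L \<Longrightarrow> Tmap \<circ> f \<in> PSL2L"
| tau_in: "f \<in> PSL2L \<Longrightarrow> tau b c d \<circ> f \<in> PSL2L"

datatype gen = GT | Gi | Gj | Gk

text \<open>A letter is a generator together with a flag: True means the inverse letter.\<close>
type_synonym letter = "gen \<times> bool"
type_synonym word = "letter list"

fun gen_map :: "gen \<Rightarrow> bool \<Rightarrow> quat \<Rightarrow> quat" where
  "gen_map GT _ = Tmap"
| "gen_map Gi e = (if e then tau (-1) 0 0 else tau 1 0 0)"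
| "gen_map Gj e = (if e then tau 0 (-1) 0 else tau 0 1 0)"
| "gen_map Gk e = (if e then tau 0 0 (-1) else tau 0 0 1)"

fun eval_word :: "word \<Rightarrow> quat \<Rightarrow> quat" where
  "eval_word [] = id"
| "eval_word ((g, e) # w) = gen_map g e \<circ> eval_word w"

definition inv_letter :: "letter \<Rightarrow> letter" where
  "inv_letter x = (fst x, \<not> snd x)"

definition winv :: "word \<Rightarrow> word" where
  "winv w = rev (map inv_letter w)"

definition comm :: "word \<Rightarrow> word \<Rightarrow> word" where
  "comm x y = x @ y @ winv x @ winv y"

definition wpow :: "word \<Rightarrow> nat \<Rightarrow> word" where
  "wpow w n = concat (replicate n w)"

text \<open>The congruence on words defining the group presented by generators and relators R:
  smallest equivalence relation compatible with concatenation in which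
  x x^-1 ~ [] and r ~ [] for r \<in> R.  The presented group is words modulo this relation,
  and the kernel of the natural map from the free group is {w. pres_eq R w []}.\<close>
inductive pres_eq :: "word set \<Rightarrow> word \<Rightarrow> word \<Rightarrow> bool" for R where
  refl: "pres_eq R w w"
| sym: "pres_eq R u v \<Longrightarrow> pres_eq R v u"
| trans: "pres_eq R u v \<Longrightarrow> pres_eq R v w \<Longrightarrow> pres_eq R u w"
| cong: "pres_eq R u v \<Longrightarrow> pres_eq R (xs @ u @ ys) (xs @ v @ ys)"
| cancel: "pres_eq R [x, inv_letter x] []"
| rel: "r \<in> R \<Longrightarrow> pres_eq R r []"

abbreviation wT :: word where "wT \<equiv> [(GT, False)]"
abbreviation wi :: word where "wi \<equiv> [(Gi, False)]"
abbreviation wj :: word where "wj \<equiv> [(Gj, False)]"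
abbreviation wk :: word where "wk \<equiv> [(Gk, False)]"

definition RL :: "word set" where
  "RL = {wpow wT 2,
         comm wi wj, comm wi wk, comm wk wj,
         wpow (wi @ wT) 6, wpow (wj @ wT) 6, wpow (wk @ wT) 6,
         wpow (wi @ wj @ wT) 4, wpow (wi @ wk @ wT) 4, wpow (wj @ wk @ wT) 4,
         wpow (wi @ wj @ wk @ wT) 6,
         wpow (wi @ wT) 3 @ wpow (wj @ wT) 3 @ wpow (wk @ wT) 3,
         wpow (wi @ wT) 3 @ wpow (wk @ wT) 3 @ wpow (wj @ wT) 3}
     \<union> {comm (wpow (u @ wT) 3) wT | u. u \<in> {wi, wj, wk}}
     \<union> {comm (wpow (u @ wT) 3) u | u. u \<in> {wi, wj, wk}}
     \<union> {wpow (u @ wT) 3 @ w @ wpow (u @ wT) 3 @ w | u w. u \<in> {wi, wj, wk} \<and> w \<in> {wi, wj, wk} \<and> u \<noteq> w}"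

end

theory Submission
  imports Defs
begin

text \<open>
  The group is the orientation-preserving half of the Coxeter group W generated by the reflections in
  the seven walls x = 0, x = 1/2, y = 0, y = 1/2, z = 0, z = 1/2, |q| = 1 of a hyperbolic polytope:
  T is the product of the reflections in |q| = 1 and x = y = z = 0, and each basic translation is
  the product of the reflections in two parallel walls. Tits' exchange argument shows that a word
  in the reflections fixing an interior point of the polytope is trivial by the Coxeter relations
  alone. Rewriting words in W of even length by the Reidemeister-Schreier method, with the
  rotations (tau_u T)^3 as products of two perpendicular reflections, turns each Coxeter relation
  into a consequence of the given relators.
\<close>

section \<open>Words in reflections\<close>

text \<open>
  A state x stands for the chamber w, via x = w^-1 x0; the sign of side s x says on which side of
  the wall s it lies. For two distinct walls the alternatives are: orthogonal, meeting at angle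
  pi/3 (with normals scaled so that the reflection in one adds the two side functions), or disjoint.
\<close>

locale mirror_system =
  fixes refl :: "'s \<Rightarrow> 'x \<Rightarrow> 'x"
    and side :: "'s \<Rightarrow> 'x \<Rightarrow> real"
    and X :: "'x set"
    and x0 :: 'x
    and eqv :: "'s list \<Rightarrow> 's list \<Rightarrow> bool"
  assumes x0_in: "x0 \<in> X"
    and refl_in: "x \<in> X \<Longrightarrow> refl s x \<in> X"
    and x0_pos: "side s x0 > 0"
    and refl_refl: "refl s (refl s x) = x"
    and side_refl: "side s (refl s x) = - side s x"
    and eqv_refl: "eqv u u"
    and eqv_sym: "eqv u v \<Longrightarrow> eqv v u"
    and eqv_trans [trans]: "eqv u v \<Longrightarrow> eqv v w \<Longrightarrow> eqv u w"
    and eqv_cong: "eqv u v \<Longrightarrow> eqv (a @ u @ b) (a @ v @ b)"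
    and eqv_square: "eqv [s, s] []"
    and trichotomy: "s \<noteq> t \<Longrightarrow>
      (eqv [s, t] [t, s] \<and> (\<forall>x. refl s (refl t x) = refl t (refl s x))
        \<and> (\<forall>x. side s (refl t x) = side s x) \<and> (\<forall>x. side t (refl s x) = side t x))
      \<or> (eqv [s, t, s] [t, s, t]
        \<and> (\<forall>x. refl s (refl t (refl s x)) = refl t (refl s (refl t x)))
        \<and> (\<forall>x. side s (refl t x) = side s x + side t x)
        \<and> (\<forall>x. side t (refl s x) = side s x + side t x))
      \<or> (\<forall>x\<in>X. side s x > 0 \<or> side t x > 0)"
begin

abbreviation end_state :: "'s list \<Rightarrow> 'x" where
  "end_state w \<equiv> fold refl w x0"

text \<open>These play the role of reduced words: each letter is appended while the state is still
  on the positive side of its wall, so the wall is crossed away from \<open>x0\<close>.\<close>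

inductive increasing :: "'s list \<Rightarrow> bool" where
  Nil: "increasing []"
| snoc: "increasing w \<Longrightarrow> side s (end_state w) > 0 \<Longrightarrow> increasing (w @ [s])"

lemma end_state_in: "end_state w \<in> X"
  by (induction w rule: rev_induct) (auto simp: x0_in refl_in)

lemma eqv_append: "eqv u v \<Longrightarrow> eqv (u @ b) (v @ b)"
  using eqv_cong[of u v "[]" b] by simp

lemma eqv_prepend: "eqv u v \<Longrightarrow> eqv (a @ u) (a @ v)"
  using eqv_cong[of u v a "[]"] by simp

text \<open>Compare \<open>s\<close> with the last letter \<open>t\<close>, for which the final
  state is negative. The braid case strips two letters and uses the hypothesis twice, hence
  induction on length.\<close>

lemma exchange:
  assumes "increasing w"
  shows "side s (end_state w) \<noteq> 0 \<and> (side s (end_state w) < 0 \<longrightarrow>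
    (\<exists>u. increasing u \<and> length w = Suc (length u) \<and> end_state w = refl s (end_state u)
      \<and> eqv w (u @ [s])))"
  using assms
proof (induction "length w" arbitrary: w s rule: less_induct)
  case less
  show ?case
    using less.prems
  proof cases
    case Nil
    then show ?thesis using x0_pos[of s] by simp
  next
    case (snoc w1 t)
    note w1 = snoc(2) and pos = snoc(3)
    have IH1: "side r (end_state w1) \<noteq> 0" "side r (end_state w1) < 0 \<Longrightarrow>
      \<exists>u. increasing u \<and> length w1 = Suc (length u) \<and> end_state w1 = refl r (end_state u)
        \<and> eqv w1 (u @ [r])" for r
      using less.hyps[of w1 r] w1 snoc(1) by auto
    define z where "z = end_state w"
    have z: "z = refl t (end_state w1)" by (simp add: z_def snoc(1))
    have z1: "end_state w1 = refl t z" by (simp add: z refl_refl)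
    have tz: "side t z < 0" using pos by (simp add: z side_refl)
    have zX: "z \<in> X" unfolding z_def by (rule end_state_in)
    show ?thesis
    proof (cases "s = t")
      case True
      have "side s z < 0" using True tz by simp
      moreover have "end_state w = refl s (end_state w1)" using True snoc(1) by simp
      ultimately show ?thesis using True w1 snoc(1) eqv_refl[of w] unfolding z_def
        by (intro conjI impI exI[of _ w1]) auto
    next
      case False
      from trichotomy[OF this] consider
        (com) "eqv [s, t] [t, s]" "\<And>x. refl s (refl t x) = refl t (refl s x)"
          "\<And>x. side s (refl t x) = side s x" "\<And>x. side t (refl s x) = side t x"
        | (braid) "eqv [s, t, s] [t, s, t]"
          "\<And>x. refl s (refl t (refl s x)) = refl t (refl s (refl t x))"
          "\<And>x. side s (refl t x) = side s x + side t x"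
          "\<And>x. side t (refl s x) = side s x + side t x"
        | (disjoint) "\<And>x. x \<in> X \<Longrightarrow> side s x > 0 \<or> side t x > 0"
        by blast
      then show ?thesis
      proof cases
        case com
        \<comment> \<open>Reflecting in \<open>t\<close> preserves the side of \<open>s\<close>, so
          the hypothesis applies to \<open>w1\<close>, and \<open>t\<close> then moves past
          \<open>s\<close>.\<close>
        have same: "side s (end_state w1) = side s z" by (simp add: z com(3))
        have "\<exists>u. increasing u \<and> length w = Suc (length u) \<and> end_state w = refl s (end_state u)
            \<and> eqv w (u @ [s])" if neg: "side s z < 0"
        proof -
          obtain u where u: "increasing u" "length w1 = Suc (length u)"
            "end_state w1 = refl s (end_state u)" "eqv w1 (u @ [s])"
            using IH1(2)[of s] neg same by auto
          have "side t (end_state u) > 0" using pos by (simp add: u(3) com(4))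
          then have "increasing (u @ [t])" using u(1) by (rule increasing.snoc[rotated])
          moreover have "eqv w ((u @ [t]) @ [s])"
            using eqv_trans[OF eqv_append[OF u(4), of "[t]"] ] eqv_prepend[OF com(1), of u]
            by (simp add: snoc(1))
          moreover have "end_state w = refl s (end_state (u @ [t]))"
            by (simp add: snoc(1) u(3) com(2))
          ultimately show ?thesis using u(2) snoc(1) by (intro exI[of _ "u @ [t]"]) auto
        qed
        then show ?thesis using IH1(1)[of s] same unfolding z_def by auto
      next
        case disjoint
        then show ?thesis using zX tz unfolding z_def by force
      next
        case braid
        \<comment> \<open>Starting from \<open>\<le>\<close> also excludes the value 0: stripping
          \<open>t\<close> and then \<open>s\<close> leaves a prefix \<open>u\<close> whose side for
          \<open>t\<close> equals \<open>side s z\<close>, which is nonzero by induction.\<close>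
        have *: "side s z < 0 \<and> (\<exists>v. increasing v \<and> length w = Suc (Suc (Suc (length v)))
            \<and> z = refl t (refl s (refl t (end_state v))) \<and> eqv w (v @ [t, s, t]))"
          if le: "side s z \<le> 0"
        proof -
          have "side s (end_state w1) < 0" using le tz by (simp add: z1 braid(3))
          then obtain u where u: "increasing u" "length w1 = Suc (length u)"
            "end_state w1 = refl s (end_state u)" "eqv w1 (u @ [s])"
            using IH1(2)[of s] by auto
          have yu: "end_state u = refl s (refl t z)" using u(3) z1 refl_refl by metis
          have "side t (end_state u) = side s z" by (simp add: yu braid(3,4) side_refl)
          moreover have "side t (end_state u) \<noteq> 0 \<and> (side t (end_state u) < 0 \<longrightarrow>
            (\<exists>v. increasing v \<and> length u = Suc (length v) \<and> end_state u = refl t (end_state v)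
              \<and> eqv u (v @ [t])))"
            using less.hyps[of u t] u(1,2) snoc(1) by simp
          ultimately have neg: "side s z < 0" and
            "\<exists>v. increasing v \<and> length u = Suc (length v) \<and> end_state u = refl t (end_state v)
              \<and> eqv u (v @ [t])"
            using le by auto
          then obtain v where v: "increasing v" "length u = Suc (length v)"
            "end_state u = refl t (end_state v)" "eqv u (v @ [t])" by auto
          have "eqv (w1 @ [t]) (u @ [s, t])" using eqv_append[OF u(4), of "[t]"] by simp
          moreover have "eqv (u @ [s, t]) (v @ [t, s, t])"
            using eqv_append[OF v(4), of "[s, t]"] by simp
          ultimately have "eqv w (v @ [t, s, t])" using snoc(1) eqv_trans by blast
          moreover have "z = refl t (refl s (refl t (end_state v)))"
            by (metis yu v(3) refl_refl)
          ultimately show ?thesis using neg v u(2) snoc(1) by auto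
        qed
        \<comment> \<open>The braid relation turns \<open>v @ [t, s, t]\<close> into
          \<open>v @ [s, t, s]\<close>; two sign computations show that \<open>v @ [s, t]\<close> is
          increasing.\<close>
        have "\<exists>u. increasing u \<and> length w = Suc (length u) \<and> end_state w = refl s (end_state u)
            \<and> eqv w (u @ [s])" if neg: "side s z < 0"
        proof -
          obtain v where v: "increasing v" "length w = Suc (Suc (Suc (length v)))"
            "z = refl t (refl s (refl t (end_state v)))" "eqv w (v @ [t, s, t])"
            using * neg by auto
          have yv: "end_state v = refl s (refl t (refl s z))"
            by (metis v(3) refl_refl braid(2))
          have "side s (end_state v) > 0" using tz
            by (simp add: yv side_refl braid(3,4))
          then have vs: "increasing (v @ [s])" using v(1) by (rule increasing.snoc[rotated])
          have "side t (end_state (v @ [s])) > 0" using neg tz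
            by (simp add: yv refl_refl side_refl braid(4))
          then have "increasing ((v @ [s]) @ [t])" using vs by (rule increasing.snoc[rotated])
          moreover have "eqv w (((v @ [s]) @ [t]) @ [s])"
            using eqv_trans[OF v(4) eqv_prepend[OF eqv_sym[OF braid(1)], of v]] by simp
          moreover have "end_state w = refl s (end_state ((v @ [s]) @ [t]))"
            using z_def v(3) by (simp add: braid(2))
          ultimately show ?thesis using v(2) by (intro exI[of _ "(v @ [s]) @ [t]"]) auto
        qed
        then show ?thesis using * unfolding z_def by force
      qed
    qed
  qed
qed

text \<open>Letters are absorbed one at a time: on the positive side the word grows, on the negative
  side \<open>exchange\<close> supplies a final \<open>s\<close> that cancels the new one.\<close>

lemma eqv_increasing:
  "\<exists>u. increasing u \<and> end_state w = end_state u \<and> eqv w u"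
proof (induction w rule: rev_induct)
  case Nil
  show ?case by (intro exI[of _ "[]"]) (simp add: increasing.Nil eqv_refl)
next
  case (snoc s w)
  then obtain u where u: "increasing u" "end_state w = end_state u" "eqv w u" by auto
  note ex = exchange[OF u(1), of s]
  show ?case
  proof (cases "side s (end_state u) > 0")
    case True
    then have "increasing (u @ [s])" using u(1) by (intro increasing.snoc)
    then show ?thesis using u eqv_append[OF u(3), of "[s]"] by (intro exI[of _ "u @ [s]"]) auto
  next
    case False
    then obtain v where v: "increasing v" "end_state u = refl s (end_state v)" "eqv u (v @ [s])"
      using ex by force
    have "eqv (w @ [s]) (u @ [s])" using eqv_append[OF u(3)] .
    also have "eqv (u @ [s]) (v @ [s, s])" using eqv_append[OF v(3), of "[s]"] by simp
    also have "eqv (v @ [s, s]) v" using eqv_prepend[OF eqv_square, of v s] by simp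
    finally show ?thesis using u v by (intro exI[of _ v]) (auto simp: refl_refl)
  qed
qed

text \<open>A nonempty increasing word ends on the negative side of the wall of its last letter,
  while \<open>x0\<close> is positive for every wall.\<close>

theorem eqv_Nil_if_fixes:
  assumes "end_state w = x0"
  shows "eqv w []"
proof -
  obtain u where u: "increasing u" "end_state w = end_state u" "eqv w u"
    using eqv_increasing by blast
  have "u = []"
    using u(1)
  proof cases
    case (snoc v s)
    have "side s (end_state u) < 0" using snoc by (simp add: side_refl)
    then show ?thesis using assms u(2) x0_pos[of s] by simp
  qed
  then show ?thesis using u(3) by simp
qed

end

section \<open>The linear model\<close>

text \<open>
  In these hyperboloid coordinates the whole group acts linearly. The mirrors Ai and Bi are the
  walls x = 0 and x = 1/2 (similarly for j, k), and S is the unit sphere.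
\<close>

datatype mirror = Ai | Aj | Ak | Bi | Bj | Bk | S

type_synonym lorentz = "real \<times> real \<times> real \<times> real \<times> real"

text \<open>With \<open>q\<close> read as a point of upper half-space at height \<open>Re q\<close>,
  its image lies on the hyperboloid n m - x^2 - y^2 - z^2 = 1.\<close>

definition vec :: "quat \<Rightarrow> lorentz" where
  "vec q = (Im_i q / Re q, Im_j q / Re q, Im_k q / Re q, qnormsq q / Re q, 1 / Re q)"

fun reflect :: "mirror \<Rightarrow> lorentz \<Rightarrow> lorentz" where
  "reflect Ai (x, y, z, n, m) = (- x, y, z, n, m)"
| "reflect Aj (x, y, z, n, m) = (x, - y, z, n, m)"
| "reflect Ak (x, y, z, n, m) = (x, y, - z, n, m)"
| "reflect Bi (x, y, z, n, m) = (m - x, y, z, n - 2 * x + m, m)"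
| "reflect Bj (x, y, z, n, m) = (x, m - y, z, n - 2 * y + m, m)"
| "reflect Bk (x, y, z, n, m) = (x, y, m - z, n - 2 * z + m, m)"
| "reflect S (x, y, z, n, m) = (x, y, z, m, n)"

text \<open>On images of \<open>vec\<close>, positivity of all seven cuts out the polytope 0 < x, y,
  z < 1/2, |q| > 1 in the imaginary parts x, y, z of q.\<close>

fun mside :: "mirror \<Rightarrow> lorentz \<Rightarrow> real" where
  "mside Ai (x, y, z, n, m) = x"
| "mside Aj (x, y, z, n, m) = y"
| "mside Ak (x, y, z, n, m) = z"
| "mside Bi (x, y, z, n, m) = m - 2 * x"
| "mside Bj (x, y, z, n, m) = m - 2 * y"
| "mside Bk (x, y, z, n, m) = m - 2 * z"
| "mside S (x, y, z, n, m) = n - m"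

text \<open>Positivity of \<open>m\<close> keeps parallel walls disjoint. As \<open>S\<close> swaps
  \<open>n\<close> and \<open>m\<close>, the quadratic inequality is added to force
  \<open>n > 0\<close> and make the set invariant.\<close>

definition future_cone :: "lorentz set" where
  "future_cone = {(x, y, z, n, m). m > 0 \<and> n * m > x\<^sup>2 + y\<^sup>2 + z\<^sup>2}"

definition base :: quat where
  "base = Quat 2 (1/4) (1/4) (1/4)"

text \<open>The rightmost mirror acts first, so \<open>[Bi, Ai]\<close> sends x to -x and then to 1
  + x. Inversion is an involution, so both flags of \<open>GT\<close> get the same mirrors.\<close>

fun mirrors_of_letter :: "letter \<Rightarrow> mirror list" where
  "mirrors_of_letter (GT, _) = [S, Ai, Aj, Ak]"
| "mirrors_of_letter (Gi, e) = (if e then [Ai, Bi] else [Bi, Ai])"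
| "mirrors_of_letter (Gj, e) = (if e then [Aj, Bj] else [Bj, Aj])"
| "mirrors_of_letter (Gk, e) = (if e then [Ak, Bk] else [Bk, Ak])"

definition mirrors :: "word \<Rightarrow> mirror list" where
  "mirrors w = concat (map mirrors_of_letter w)"

definition lin :: "word \<Rightarrow> lorentz \<Rightarrow> lorentz" where
  "lin w = foldr reflect (mirrors w)"

lemma mirrors_simps [simp]:
  "mirrors [] = []"
  "mirrors (l # w) = mirrors_of_letter l @ mirrors w"
  by (simp_all add: mirrors_def)

lemma lin_Nil [simp]: "lin [] p = p"
  by (simp add: lin_def)

lemma lin_Cons: "lin (l # w) p = foldr reflect (mirrors_of_letter l) (lin w p)"
  by (simp add: lin_def)

lemma lin_append: "lin (u @ v) p = lin u (lin v p)"
  by (simp add: lin_def mirrors_def)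

lemma reflect_reflect [simp]: "reflect s (reflect s p) = p"
  by (cases s; cases p) auto

lemma fold_foldr_reflect: "fold reflect w (foldr reflect w p) = p"
  by (induction w arbitrary: p) auto

lemma lin_letters:
  "lin ((GT, e) # w) p = (case lin w p of (x, y, z, n, m) \<Rightarrow> (- x, - y, - z, m, n))"
  "lin ((Gi, e) # w) p = (case lin w p of (x, y, z, n, m) \<Rightarrow>
     if e then (x - m, y, z, n - 2 * x + m, m) else (x + m, y, z, n + 2 * x + m, m))"
  "lin ((Gj, e) # w) p = (case lin w p of (x, y, z, n, m) \<Rightarrow>
     if e then (x, y - m, z, n - 2 * y + m, m) else (x, y + m, z, n + 2 * y + m, m))"
  "lin ((Gk, e) # w) p = (case lin w p of (x, y, z, n, m) \<Rightarrow>
     if e then (x, y, z - m, n - 2 * z + m, m) else (x, y, z + m, n + 2 * z + m, m))"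
  by (cases "lin w p"; simp add: lin_Cons)+

text \<open>The linear action involves no division, so evaluation at a symbolic vector reduces each
  relator to ring identities.\<close>

lemma lin_relator:
  assumes "r \<in> RL"
  shows "lin r p = p"
proof -
  obtain x y z n m where "p = (x, y, z, n, m)" by (cases p)
  then show ?thesis using assms
    by (auto simp: RL_def wpow_def comm_def winv_def inv_letter_def lin_letters
        numeral_eq_Suc algebra_simps)
qed

lemma lin_cancel: "lin [x, inv_letter x] p = p"
proof (cases x)
  case (Pair g e)
  then show ?thesis by (cases g; cases p) (auto simp: inv_letter_def lin_letters)
qed

lemma lin_pres_eq: "pres_eq RL u v \<Longrightarrow> lin u p = lin v p"
  by (induction arbitrary: p rule: pres_eq.induct) (simp_all add: lin_append lin_relator lin_cancel)

section \<open>The action on \<open>H1\<close> compared with the linear action\<close>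

lemma qnormsq_pos: "q \<in> H1 \<Longrightarrow> qnormsq q > 0"
  unfolding H1_def qnormsq_def by (auto intro!: add_pos_nonneg)

lemma gen_map_H1: "q \<in> H1 \<Longrightarrow> gen_map g e q \<in> H1"
  using qnormsq_pos[of q]
  by (cases g) (auto simp: H1_def Tmap_def qinv_def tau_def qadd_def)

lemma eval_word_H1: "q \<in> H1 \<Longrightarrow> eval_word w q \<in> H1"
  by (induction w) (auto simp: gen_map_H1)

lemma qnormsq_qinv: "qnormsq (qinv q) = 1 / qnormsq q"
proof -
  have "qnormsq (qinv q) = qnormsq q / (qnormsq q)\<^sup>2"
    by (simp add: qinv_def qnormsq_def power_divide flip: add_divide_distrib)
  then show ?thesis by (simp add: power2_eq_square)
qed

lemma vec_gen_map:
  assumes "q \<in> H1"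
  shows "vec (gen_map g e q) = foldr reflect (mirrors_of_letter (g, e)) (vec q)"
proof -
  have r: "Re q > 0" using assms by (simp add: H1_def)
  show ?thesis
  proof (cases g)
    case GT
    have "Re (qinv q) = Re q / qnormsq q" "Im_i (qinv q) = - Im_i q / qnormsq q"
      "Im_j (qinv q) = - Im_j q / qnormsq q" "Im_k (qinv q) = - Im_k q / qnormsq q"
      by (simp_all add: qinv_def)
    then show ?thesis using GT r qnormsq_pos[OF assms]
      by (simp add: Tmap_def vec_def qnormsq_qinv)
  qed (use r in \<open>simp_all add: vec_def tau_def qadd_def qnormsq_def field_simps power2_eq_square\<close>)
qed

lemma vec_eval_word: "q \<in> H1 \<Longrightarrow> vec (eval_word w q) = lin w (vec q)"
proof (induction w)
  case (Cons l w)
  then show ?case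
    by (cases l) (simp add: vec_gen_map eval_word_H1 lin_Cons)
qed simp

lemma vec_inject:
  assumes "p \<in> H1" "q \<in> H1" "vec p = vec q"
  shows "p = q"
  using assms by (cases p; cases q) (auto simp: vec_def H1_def)

lemma reflect_future_cone:
  assumes "p \<in> future_cone"
  shows "reflect s p \<in> future_cone"
proof -
  obtain x y z n m where p: "p = (x, y, z, n, m)" by (cases p)
  have m: "m > 0" and c: "n * m > x\<^sup>2 + y\<^sup>2 + z\<^sup>2" using assms by (auto simp: p future_cone_def)
  have "n * m > 0" using c by (smt (verit) zero_le_power2)
  then have "n > 0" using m by (simp add: zero_less_mult_iff)
  then show ?thesis using m c
    by (cases s) (auto simp: p future_cone_def power2_eq_square algebra_simps)
qed

section \<open>The even reflection words in the presented group\<close>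

\<comment> \<open>The presented group, handled below as a monoid in which the class of
  \<open>winv w\<close> inverts that of \<open>w\<close>.\<close>
quotient_type presented = word / "pres_eq RL"
  by (intro equivpI reflpI sympI transpI) (auto intro: pres_eq.intros)

lemma pres_eq_append:
  assumes "pres_eq R u u'" "pres_eq R v v'"
  shows "pres_eq R (u @ v) (u' @ v')"
  using pres_eq.cong[OF assms(1), of "[]" v] pres_eq.cong[OF assms(2), of u' "[]"]
  by (auto intro: pres_eq.trans)

instantiation presented :: monoid_mult
begin

lift_definition one_presented :: presented is "[]" .

lift_definition times_presented :: "presented \<Rightarrow> presented \<Rightarrow> presented" is "(@)"
  by (rule pres_eq_append)

instance
  by standard (transfer; simp add: pres_eq.refl)+

end

abbreviation cls :: "word \<Rightarrow> presented" where
  "cls \<equiv> abs_presented"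

lemma cls_append: "cls (u @ v) = cls u * cls v"
  by (simp add: times_presented.abs_eq)

lemma cls_Nil: "cls [] = 1"
  by (simp add: one_presented_def)

lemma cls_eq_iff: "cls u = cls v \<longleftrightarrow> pres_eq RL u v"
  by (rule presented.abs_eq_iff)

lemma cls_cancel: "cls [x] * cls [inv_letter x] = 1"
  using pres_eq.cancel[of RL x] by (simp flip: cls_append cls_Nil add: cls_eq_iff)

lemma cls_winv: "cls w * cls (winv w) = 1"
proof (induction w)
  case (Cons x w)
  have "cls (x # w) * cls (winv (x # w)) = cls [x] * (cls w * cls (winv w)) * cls [inv_letter x]"
    by (simp add: winv_def mult.assoc flip: cls_append)
  then show ?case using Cons cls_cancel by simp
qed (simp add: winv_def cls_Nil)

lemma cls_relator: "r \<in> RL \<Longrightarrow> cls r = 1"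
  unfolding cls_Nil[symmetric] cls_eq_iff by (rule pres_eq.rel)

section \<open>Consequences of the relators\<close>

lemma right_mult_eq: "a * b = (1 :: 'a :: monoid_mult) \<Longrightarrow> b * c = 1 \<Longrightarrow> a = c"
  by (metis mult.assoc mult_1_left mult_1_right)

lemma cls_comm:
  assumes "comm u v \<in> RL"
  shows "cls u * cls v = cls v * cls u"
proof -
  have "cls (u @ v) * cls (winv u @ winv v) = 1"
    using cls_relator[OF assms] by (simp add: comm_def flip: cls_append)
  moreover have "cls (winv u @ winv v) * cls (v @ u) = 1"
    using cls_winv[of "winv u @ winv v"]
    by (simp add: winv_def rev_map comp_def inv_letter_def)
  ultimately have "cls (u @ v) = cls (v @ u)" by (rule right_mult_eq)
  then show ?thesis by (simp add: cls_append)
qed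

text \<open>The half-turn sending q to u q u^{-1}; geometrically, the product of the reflections in
  the two \<open>A\<close> mirrors belonging to the other two directions.\<close>

definition rot :: "word \<Rightarrow> presented" where
  "rot u = cls (wpow (u @ wT) 3)"

lemma T_T: "cls wT * cls wT = 1"
  using cls_relator[of "wpow wT 2"] by (simp add: RL_def wpow_def numeral_2_eq_2 flip: cls_append)

lemma translation_commute:
  "cls wj * cls wi = cls wi * cls wj"
  "cls wk * cls wi = cls wi * cls wk"
  "cls wk * cls wj = cls wj * cls wk"
  using cls_comm[of wi wj] cls_comm[of wi wk] cls_comm[of wk wj] by (simp_all add: RL_def)

lemma rot_eq: "rot u = cls u * (cls wT * (cls u * (cls wT * (cls u * cls wT))))"
  by (simp add: rot_def wpow_def numeral_3_eq_3 flip: cls_append)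

lemma winv_winv: "winv (winv w) = w"
  by (simp add: winv_def rev_map comp_def inv_letter_def)

lemma winv_cls: "cls (winv w) * cls w = 1"
  using cls_winv[of "winv w"] by (simp add: winv_winv)

lemma commute_winv:
  assumes "cls u * x = x * cls u"
  shows "cls (winv u) * x = x * cls (winv u)"
proof -
  have "cls (winv u) * x = cls (winv u) * (x * cls u) * cls (winv u)"
    by (simp add: mult.assoc cls_winv)
  also have "\<dots> = (cls (winv u) * cls u) * x * cls (winv u)"
    by (simp add: mult.assoc flip: assms)
  finally show ?thesis by (simp add: winv_cls)
qed

context
  fixes u :: word
  assumes u: "u \<in> {wi, wj, wk}"
begin

lemma rot_rot: "rot u * rot u = 1"
proof -
  have "wpow (u @ wT) 6 \<in> RL" using u by (auto simp: RL_def)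
  moreover have "wpow (u @ wT) 6 = wpow (u @ wT) 3 @ wpow (u @ wT) 3"
    by (simp add: wpow_def numeral_eq_Suc)
  ultimately show ?thesis using cls_relator by (metis rot_def cls_append)
qed

lemma rot_T: "rot u * cls wT = cls wT * rot u"
  unfolding rot_def by (rule cls_comm) (use u in \<open>auto simp: RL_def\<close>)

lemma rot_self: "rot u * cls u = cls u * rot u"
  unfolding rot_def by (rule cls_comm) (use u in \<open>auto simp: RL_def\<close>)

lemma rot_self_inverse: "rot u * cls (winv u) = cls (winv u) * rot u"
  using commute_winv[of u "rot u"] rot_self by simp

text \<open>A half-turn reverses translations perpendicular to its axis: the relator makes
  \<open>rot u * cls w\<close> an involution, and so is \<open>rot u\<close>.\<close>

lemma rot_other:
  assumes "w \<in> {wi, wj, wk}" "u \<noteq> w"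
  shows "rot u * cls w = cls (winv w) * rot u" "rot u * cls (winv w) = cls w * rot u"
proof -
  have "wpow (u @ wT) 3 @ w @ wpow (u @ wT) 3 @ w \<in> RL" using u assms unfolding RL_def by blast
  then have *: "(rot u * cls w) * (rot u * cls w) = 1"
    using cls_relator unfolding rot_def by (simp add: mult.assoc flip: cls_append)
  have "(rot u * cls w) * (cls (winv w) * rot u) = rot u * (cls w * cls (winv w)) * rot u"
    by (simp only: mult.assoc)
  then have "(rot u * cls w) * (cls (winv w) * rot u) = 1"
    by (simp add: cls_winv rot_rot)
  with * show eq: "rot u * cls w = cls (winv w) * rot u" by (rule right_mult_eq)
  have "rot u * cls (winv w) = rot u * (cls (winv w) * rot u) * rot u"
    by (simp add: mult.assoc rot_rot)
  also have "\<dots> = (rot u * rot u) * cls w * rot u"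
    by (simp only: mult.assoc flip: eq)
  finally show "rot u * cls (winv w) = cls w * rot u"
    by (simp add: rot_rot)
qed

text \<open>The definition of \<open>rot u\<close> solved for T u T; this lowers the number of
  letters T.\<close>

lemma T_u_T:
  "cls wT * (cls u * cls wT) = cls (winv u) * (cls wT * (cls (winv u) * rot u))"
proof -
  have "cls (winv u) * (cls wT * (cls (winv u) * rot u))
      = cls (winv u) * (cls wT * ((cls (winv u) * cls u) * (cls wT * (cls u * (cls wT * (cls u * cls wT))))))"
    by (simp only: rot_eq mult.assoc)
  also have "\<dots> = cls (winv u) * ((cls wT * cls wT) * (cls u * (cls wT * (cls u * cls wT))))"
    by (simp only: winv_cls mult_1_left mult.assoc)
  also have "\<dots> = (cls (winv u) * cls u) * (cls wT * (cls u * cls wT))"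
    by (simp only: T_T mult_1_left mult.assoc)
  finally show ?thesis by (simp add: winv_cls)
qed

text \<open>Both sides invert T u T, the right side because \<open>rot u\<close> is an involution
  commuting with T and u.\<close>

lemma T_winv_T:
  "cls wT * (cls (winv u) * cls wT) = cls u * (cls wT * (cls u * rot u))"
proof -
  have "(cls u * (cls wT * (cls u * rot u))) * (cls wT * (cls u * cls wT))
      = cls u * (cls wT * (cls u * (cls wT * (cls u * (cls wT * rot u)))))"
    by (simp only: mult.assoc rot_T rot_self) (metis mult.assoc rot_T rot_self)
  also have "\<dots> = rot u * rot u"
    unfolding rot_eq by (simp only: mult.assoc)
  finally have 1: "(cls u * (cls wT * (cls u * rot u))) * (cls wT * (cls u * cls wT)) = 1"
    by (simp add: rot_rot)
  have "(cls wT * (cls u * cls wT)) * (cls wT * (cls (winv u) * cls wT))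
      = cls wT * (cls u * ((cls wT * cls wT) * (cls (winv u) * cls wT)))"
    by (simp only: mult.assoc)
  also have "\<dots> = cls wT * ((cls u * cls (winv u)) * cls wT)"
    by (simp only: T_T mult_1_left mult.assoc)
  finally have "(cls wT * (cls u * cls wT)) * (cls wT * (cls (winv u) * cls wT)) = 1"
    by (simp add: cls_winv T_T)
  with 1 show ?thesis using right_mult_eq by metis
qed

end

text \<open>The two triple relators, one for each order, make the three involutions the nontrivial
  elements of a Klein four-group.\<close>

lemma rot_klein:
  "rot wi * rot wj = rot wk" "rot wj * rot wi = rot wk"
  "rot wi * rot wk = rot wj" "rot wk * rot wi = rot wj"
  "rot wj * rot wk = rot wi" "rot wk * rot wj = rot wi"
proof -
  have sq: "rot wi * rot wi = 1" "rot wj * rot wj = 1" "rot wk * rot wk = 1"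
    by (simp_all add: rot_rot)
  have "rot wi * (rot wj * rot wk) = 1" "rot wi * (rot wk * rot wj) = 1"
    using cls_relator[of "wpow (wi @ wT) 3 @ wpow (wj @ wT) 3 @ wpow (wk @ wT) 3"]
      cls_relator[of "wpow (wi @ wT) 3 @ wpow (wk @ wT) 3 @ wpow (wj @ wT) 3"]
    unfolding rot_def by (simp_all add: RL_def flip: cls_append)
  then show jk: "rot wj * rot wk = rot wi" and kj: "rot wk * rot wj = rot wi"
    using right_mult_eq[OF sq(1)] by metis+
  show "rot wi * rot wj = rot wk"
    using sq by (metis kj mult.assoc mult_1_right)
  show "rot wi * rot wk = rot wj"
    using sq by (metis jk mult.assoc mult_1_right)
  show "rot wj * rot wi = rot wk"
    using sq by (metis jk mult.assoc mult_1_left)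
  show "rot wk * rot wi = rot wj"
    using sq by (metis kj mult.assoc mult_1_left)
qed

lemma winv_gen: "winv [(g, e)] = [(g, \<not> e)]"
  by (simp add: winv_def inv_letter_def)

text \<open>Left-to-right these rules move rotations to the right, sort the translations and shorten
  every factor T u T, so that they decide all the identities needed below.\<close>

lemmas normalize_rules =
  T_T rot_klein translation_commute
  cls_winv[of wi] cls_winv[of wj] cls_winv[of wk]
  winv_cls[of wi] winv_cls[of wj] winv_cls[of wk]
  rot_rot[of wi] rot_rot[of wj] rot_rot[of wk]
  rot_T[of wi] rot_T[of wj] rot_T[of wk]
  rot_self[of wi] rot_self[of wj] rot_self[of wk]
  rot_self_inverse[of wi] rot_self_inverse[of wj] rot_self_inverse[of wk]
  rot_other[of wi wj] rot_other[of wi wk] rot_other[of wj wi]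
  rot_other[of wj wk] rot_other[of wk wi] rot_other[of wk wj]
  commute_winv[OF translation_commute(1)]
  commute_winv[OF translation_commute(2)]
  commute_winv[OF translation_commute(3)]
  commute_winv[OF translation_commute(1)[symmetric], symmetric]
  commute_winv[OF translation_commute(2)[symmetric], symmetric]
  commute_winv[OF translation_commute(3)[symmetric], symmetric]
  commute_winv[OF commute_winv[OF translation_commute(1)[symmetric], symmetric]]
  commute_winv[OF commute_winv[OF translation_commute(2)[symmetric], symmetric]]
  commute_winv[OF commute_winv[OF translation_commute(3)[symmetric], symmetric]]

text \<open>Extends a rule for \<open>a * b\<close> to the head of a longer right-nested
  product.\<close>

lemma mult_left_eq:
  fixes a b c z :: "'a :: monoid_mult"
  shows "a * b = c \<Longrightarrow> a * (b * z) = c * z"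
  by (simp flip: mult.assoc)

lemmas T_translation_T =
  T_u_T[of wi] T_u_T[of wj] T_u_T[of wk] T_winv_T[of wi] T_winv_T[of wj] T_winv_T[of wk]

text \<open>The pattern T u T has three factors, so \<open>mult_left_eq\<close> would not yield the
  right-nested form.\<close>

lemma T_translation_T_left:
  assumes "u \<in> {wi, wj, wk}"
  shows "cls wT * (cls u * (cls wT * z)) = cls (winv u) * (cls wT * (cls (winv u) * (rot u * z)))"
    "cls wT * (cls (winv u) * (cls wT * z)) = cls u * (cls wT * (cls u * (rot u * z)))"
  using arg_cong[OF T_u_T[OF assms], of "\<lambda>x. x * z"] arg_cong[OF T_winv_T[OF assms], of "\<lambda>x. x * z"]
  by (simp_all only: mult.assoc)

lemmas normalize = normalize_rules[simplified winv_gen, simplified]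
  normalize_rules[THEN mult_left_eq, simplified winv_gen, simplified]
  T_translation_T[simplified winv_gen, simplified]
  T_translation_T_left[of wi, simplified winv_gen, simplified]
  T_translation_T_left[of wj, simplified winv_gen, simplified]
  T_translation_T_left[of wk, simplified winv_gen, simplified]
  mult.assoc

section \<open>Reidemeister-Schreier rewriting of mirror words\<close>

text \<open>For a mirror s, coset_gen s False is s Ai and coset_gen s True is Ai s: these are the
  Schreier generators of the even subgroup for the transversal (1, Ai).\<close>

fun coset_gen :: "mirror \<Rightarrow> bool \<Rightarrow> presented" where
  "coset_gen Ai _ = 1"
| "coset_gen Aj _ = rot wk"
| "coset_gen Ak _ = rot wj"
| "coset_gen Bi e = cls [(Gi, e)]"
| "coset_gen Bj _ = cls wj * rot wk"
| "coset_gen Bk _ = cls wk * rot wj"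
| "coset_gen S _ = cls wT * rot wi"

text \<open>The flag is the current coset, \<open>True\<close> being that of \<open>Ai\<close>. Each
  mirror changes the coset, which amounts to inserting \<open>Ai\<close> twice between neighbouring
  letters.\<close>

fun rewrite_word :: "bool \<Rightarrow> mirror list \<Rightarrow> presented" where
  "rewrite_word e [] = 1"
| "rewrite_word e (s # w) = coset_gen s e * rewrite_word (\<not> e) w"

lemma rewrite_word_append:
  "rewrite_word e (u @ v) = rewrite_word e u * rewrite_word (if even (length u) then e else \<not> e) v"
  by (induction u arbitrary: e) (auto simp: mult.assoc)

lemma rewrite_word_mirrors: "rewrite_word False (mirrors w) = cls w"
proof (induction w)
  case (Cons l w)
  obtain g e where l: "l = (g, e)" by (cases l)
  \<comment> \<open>The inverse letter of T has the same mirrors as T, so the two classes must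
    agree.\<close>
  have T': "cls [(GT, True)] = cls wT"
    using right_mult_eq[OF T_T cls_winv[of wT]] by (simp add: winv_gen)
  have "rewrite_word False (mirrors_of_letter l) = cls [l]"
    unfolding l by (cases g; cases e) (simp_all add: normalize T')
  moreover have "even (length (mirrors_of_letter l))"
    unfolding l by (cases g) simp_all
  moreover have "cls (l # w) = cls [l] * cls w" by (simp flip: cls_append)
  ultimately show ?case using Cons by (simp add: rewrite_word_append)
qed (simp add: cls_Nil)

text \<open>Both starting flags and the parity are compared so that the relation is a congruence: a
  prefix of odd length flips the flag.\<close>

definition meqv :: "mirror list \<Rightarrow> mirror list \<Rightarrow> bool" where
  "meqv u v \<longleftrightarrow> even (length u) = even (length v) \<and> (\<forall>e. rewrite_word e u = rewrite_word e v)"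

lemma meqv_square: "meqv [s, s] []"
  unfolding meqv_def all_bool_eq
  by (cases s) (simp_all add: normalize)

text \<open>The walls of \<open>Ai\<close> and \<open>Bi\<close> (likewise for j, k) are parallel,
  \<open>S\<close> meets each \<open>B\<close> wall at angle pi/3, and all other pairs are
  orthogonal.\<close>

lemma mirror_trichotomy:
  assumes "s \<noteq> t"
  shows "(meqv [s, t] [t, s] \<and> (\<forall>x. reflect s (reflect t x) = reflect t (reflect s x))
        \<and> (\<forall>x. mside s (reflect t x) = mside s x) \<and> (\<forall>x. mside t (reflect s x) = mside t x))
      \<or> (meqv [s, t, s] [t, s, t]
        \<and> (\<forall>x. reflect s (reflect t (reflect s x)) = reflect t (reflect s (reflect t x)))
        \<and> (\<forall>x. mside s (reflect t x) = mside s x + mside t x)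
        \<and> (\<forall>x. mside t (reflect s x) = mside s x + mside t x))
      \<or> (\<forall>x\<in>future_cone. mside s x > 0 \<or> mside t x > 0)" (is "?com \<or> ?braid \<or> ?disjoint")
proof -
  consider "{s, t} = {Ai, Bi} \<or> {s, t} = {Aj, Bj} \<or> {s, t} = {Ak, Bk}"
    | "{s, t} = {S, Bi} \<or> {s, t} = {S, Bj} \<or> {s, t} = {S, Bk}"
    | "\<not> ({s, t} = {Ai, Bi} \<or> {s, t} = {Aj, Bj} \<or> {s, t} = {Ak, Bk}
        \<or> {s, t} = {S, Bi} \<or> {s, t} = {S, Bj} \<or> {s, t} = {S, Bk})"
    by argo
  then show ?thesis
  proof cases
    case 1
    \<comment> \<open>The side functions satisfy 2 x + (m - 2 x) = m > 0, so they cannot both be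
      nonpositive.\<close>
    then have ?disjoint
      by (elim disjE) (auto simp: doubleton_eq_iff future_cone_def)
    then show ?thesis by blast
  next
    case 2
    \<comment> \<open>After rewriting, the braid relation becomes the rules for T u T and its
      inverse.\<close>
    then have "meqv [s, t, s] [t, s, t]"
      unfolding meqv_def all_bool_eq doubleton_eq_iff
      by (elim disjE conjE) (simp_all add: normalize)
    moreover from 2 have "reflect s (reflect t (reflect s x)) = reflect t (reflect s (reflect t x))"
      "mside s (reflect t x) = mside s x + mside t x"
      "mside t (reflect s x) = mside s x + mside t x" for x
      unfolding doubleton_eq_iff by (cases x; elim disjE conjE; simp)+
    ultimately have ?braid by blast
    then show ?thesis by blast
  next
    case 3
    then have "meqv [s, t] [t, s]" using assms
      unfolding meqv_def all_bool_eq doubleton_eq_iff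
      by (cases s; cases t) (simp_all add: normalize)
    moreover from 3 assms have "reflect s (reflect t x) = reflect t (reflect s x)"
      "mside s (reflect t x) = mside s x" "mside t (reflect s x) = mside t x" for x
      unfolding doubleton_eq_iff by (cases x; cases s; cases t; simp)+
    ultimately have ?com by blast
    then show ?thesis by blast
  qed
qed

lemma meqv_cong:
  assumes "meqv u v"
  shows "meqv (a @ u @ b) (a @ v @ b)"
  using assms by (auto simp: meqv_def rewrite_word_append)

interpretation mirrors: mirror_system reflect mside future_cone "vec base" meqv
proof
  show "vec base \<in> future_cone"
    by (simp add: future_cone_def vec_def base_def qnormsq_def power2_eq_square)
  show "mside s (vec base) > 0" for s
    by (cases s) (simp_all add: vec_def base_def qnormsq_def power2_eq_square)
  show "mside s (reflect s x) = - mside s x" for s x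
    by (cases s; cases x) auto
qed (rule mirror_trichotomy reflect_future_cone reflect_reflect meqv_square meqv_cong, assumption?
    | simp add: meqv_def)+

theorem pres_eq_Nil_if_lin_fixes:
  assumes "lin w (vec base) = vec base"
  shows "pres_eq RL w []"
proof -
  \<comment> \<open>\<open>fold\<close> applies the inverse of the map \<open>lin w\<close>, which
    therefore fixes the base vector too.\<close>
  have "fold reflect (mirrors w) (vec base) = vec base"
    using fold_foldr_reflect[of "mirrors w" "vec base"] assms by (simp add: lin_def)
  then have "meqv (mirrors w) []" by (rule mirrors.eqv_Nil_if_fixes)
  then have "cls w = cls []"
    by (simp add: meqv_def cls_Nil flip: rewrite_word_mirrors)
  then show ?thesis by (simp add: cls_eq_iff)
qed

section \<open>The presentation\<close>

lemma eval_word_append: "eval_word (u @ v) = eval_word u \<circ> eval_word v"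
proof (induction u)
  case (Cons l u)
  then show ?case by (cases l) (simp add: comp_assoc)
qed simp

lemma eval_word_in_PSL2L: "eval_word w \<in> PSL2L"
proof (induction w)
  case (Cons l w)
  obtain g e where l: "l = (g, e)" by (cases l)
  show ?case unfolding l using Cons
    by (cases g; cases e) (simp_all only: eval_word.simps gen_map.simps PSL2L.T_in PSL2L.tau_in if_True if_False)
qed (simp only: eval_word.simps PSL2L.id_in)

definition translation_word :: "gen \<Rightarrow> int \<Rightarrow> word" where
  "translation_word g b = replicate (nat \<bar>b\<bar>) (g, b < 0)"

lemma tau_tau: "tau b c d (tau b' c' d' q) = tau (b + b') (c + c') (d + d') q"
  by (simp add: tau_def qadd_def)

lemma tau_0: "tau 0 0 0 q = q"
  by (simp add: tau_def qadd_def)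

lemma eval_replicate:
  "eval_word (replicate n (Gi, e)) q = tau (if e then - int n else int n) 0 0 q"
  "eval_word (replicate n (Gj, e)) q = tau 0 (if e then - int n else int n) 0 q"
  "eval_word (replicate n (Gk, e)) q = tau 0 0 (if e then - int n else int n) q"
  by (induction n) (auto simp: tau_tau tau_0)

lemma eval_translation:
  "eval_word (translation_word Gi b @ translation_word Gj c @ translation_word Gk d) = tau b c d"
proof -
  have "eval_word (translation_word Gi b) q = tau b 0 0 q"
    "eval_word (translation_word Gj c) q = tau 0 c 0 q"
    "eval_word (translation_word Gk d) q = tau 0 0 d q" for q
    by (auto simp: translation_word_def eval_replicate)
  then show ?thesis by (simp add: fun_eq_iff eval_word_append tau_tau)
qed

lemma PSL2L_eval_word: "f \<in> PSL2L \<Longrightarrow> \<exists>w. f = eval_word w"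
proof (induction rule: PSL2L.induct)
  case id_in
  show ?case by (intro exI[of _ "[]"]) simp
next
  case (T_in f)
  then obtain w where "f = eval_word w" by auto
  then show ?case by (intro exI[of _ "(GT, False) # w"]) simp
next
  case (tau_in f b c d)
  then obtain w where "f = eval_word w" by auto
  then have "tau b c d \<circ> f
      = eval_word ((translation_word Gi b @ translation_word Gj c @ translation_word Gk d) @ w)"
    by (simp only: eval_word_append[of "_ @ _" w] eval_translation)
  then show ?case by blast
qed

text \<open>Triviality at the single point \<open>base\<close> already yields a derivation from the
  relators; conversely, relators act trivially in the linear model and \<open>vec\<close> is
  injective on \<open>H1\<close>.\<close>

lemma fixes_iff_pres_eq: "(\<forall>q \<in> H1. eval_word w q = q) \<longleftrightarrow> pres_eq RL w []"
proof
  assume fixed: "\<forall>q \<in> H1. eval_word w q = q"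
  have "base \<in> H1" by (simp add: H1_def base_def)
  then have "lin w (vec base) = vec base" using fixed vec_eval_word by metis
  then show "pres_eq RL w []" by (rule pres_eq_Nil_if_lin_fixes)
next
  assume "pres_eq RL w []"
  then have "lin w p = p" for p using lin_pres_eq by fastforce
  then show "\<forall>q \<in> H1. eval_word w q = q"
    using vec_inject eval_word_H1 vec_eval_word by metis
qed

text \<open>Evaluation is onto the group, up to agreement on \<open>H1\<close>, and its kernel
  consists of the consequences of the relators; this is the meaning of a presentation.\<close>

theorem theorem8p1:
  shows "(\<forall>w. eval_word w \<in> PSL2L)
       \<and> (\<forall>f \<in> PSL2L. \<exists>w. \<forall>q \<in> H1. f q = eval_word w q)
       \<and> (\<forall>w. (\<forall>q \<in> H1. eval_word w q = q) \<longleftrightarrow> pres_eq RL w [])"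
  using eval_word_in_PSL2L PSL2L_eval_word fixes_iff_pres_eq by blast

end
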